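(* Let $\eta_{\rm inv}(q_{\mathcal{A}})$ and $\eta_{\rm mat}(q_{\mathcal{A}})$ refer to the number of flops necessary to carry out, respectively, the matrix inversion $\Phi=(G_{\mathcal{A}}H^{-1}(G_{\mathcal{A}})')^{-1}$ and all other matrix operations needed (in approach A1) to evaluate the formulas for $K^\star_{\mathcal{M}}$, $b^\star_{\mathcal{M}}$, $T^\star$, $d^\star$ given in the context. Assume the constraints $u(k)\in\mathcal{U}$, $x(k)\in\mathcal{X}$ ($k=0,\dots,N-1$) and $x(N)\in\mathcal{T}$ are box constraints, which implies $q=2mN+2nN+2n$, and assume $N>1$. Then $$\frac{\eta_{\rm inv}(q_{\mathcal{A}})}{\eta_{\rm mat}(q_{\mathcal{A}})}\le\frac{18}{79}.$$
   Context: Setting. The optimal control problem is $$\min_{u(0),\dots,u(N-1),\,x(1),\dots,x(N)} x(N)'Px(N)+\sum_{k=0}^{N-1}\big(x(k)'Qx(k)+u(k)'Ru(k)\big)$$ subject to $x(k+1)=Ax(k)+Bu(k)$, $u(k)\in\mathcal{U}$, $x(k)\in\mathcal{X}$ for $k=0,\dots,N-1$, $x(N)\in\mathcal{T}$, and $x(0)=x$ given. Here $x(k)\in\mathbb{R}^n$, $u(k)\in\mathbb{R}^m$, $n,m\ge1$, $N$ is an integer, $P\succ0$, $Q\succeq0$, $R\succ0$, $(A,B)$ is stabilizable, and $\mathcal{U}\subset\mathbb{R}^m$, $\mathcal{X}\subset\mathbb{R}^n$, $\mathcal{T}\subseteq\mathcal{X}$ are compact polytopes containing the origin in their interiors. It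 is written equivalently as the quadratic program $\min_U \frac12U'HU+x'FU$ s.t. $GU-Ex\le w$ with $U\in\mathbb{R}^{mN}$, $H\succ0$, $F\in\mathbb{R}^{n\times mN}$, $G\in\mathbb{R}^{q\times mN}$, $E\in\mathbb{R}^{q\times n}$, $w\in\mathbb{R}^q$, where $q$ is the number of scalar constraints. For a feasible $x$ with unique optimizer $U^\star(x)$, the active and inactive sets are $\mathcal{A}=\{i: G_iU^\star(x)-E_ix=w_i\}$ and $\mathcal{I}=\{i: G_iU^\star(x)-E_ix<w_i\}$, and $q_{\mathcal{A}}=|\mathcal{A}|$. $M_{\mathcal{S}}$ denotes the submatrix of rows of $M$ with indices in $\mathcal{S}$. $G_{\mathcal{A}}\in\mathbb{R}^{q_{\mathcal{A}}\times mN}$ is assumed to have full row rank (so $q_{\mathcal{A}}\le mN$). With $\mathcal{M}=\{1,\dots,m\}$, $S=E+GH^{-1}F'$, $\Phi=(G_{\mathcal{A}}H^{-1}(G_{\mathcal{A}})')^{-1}\in\mathbb{R}^{q_{\mathcal{A}}\times q_{\mathcal{A}}}$, and $H^{-1}_{\mathcal{M}}$ the first $m$ rows of $H^{-1}$, the optimal feedback law $K^\star_{\mathcal{M}}x+b^\star_{\mathcal{M}}$ and its polytope of validity $\{x:T^\star x\le d^\star\}$ are given by $$K^\star_{\mathcal{M}}=H^{-1}_{\mathcal{M}}(G_{\mathcal{A}})'\Phi S_{\mathcal{A}}-H^{-1}_{\mathcal{M}}F',\qquad b^\star_{\mathcal{M}}=H^{-1}_{\mathcal{M}}(G_{\mathcal{A}})'\Phi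 w_{\mathcal{A}},$$ $$T^\star=\begin{pmatrix}G_{\mathcal{I}}H^{-1}(G_{\mathcal{A}})'\Phi S_{\mathcal{A}}-S_{\mathcal{I}}\\ \Phi S_{\mathcal{A}}\end{pmatrix},\qquad d^\star=-\begin{pmatrix}G_{\mathcal{I}}H^{-1}(G_{\mathcal{A}})'\Phi w_{\mathcal{A}}-w_{\mathcal{I}}\\ \Phi w_{\mathcal{A}}\end{pmatrix}.$$ Approach A1: the local node receives only $\mathcal{A}$ and evaluates all of these formulas, including the inversion. Flop counting conventions: a multiplication or addition costs one flop, a division ten flops; inverting an $r\times r$ matrix costs $\frac{2r^3+18r^2+10r}{3}$ flops, so $\eta_{\rm inv}(q_{\mathcal{A}})=\frac13(2q_{\mathcal{A}}^3+18q_{\mathcal{A}}^2+10q_{\mathcal{A}})$. The total number of flops of approach A1 is $$\eta(q_{\mathcal{A}})=(mNq_{\mathcal{A}}+mn+qq_{\mathcal{A}})(2mN-1)+(qn+q+m+mn)(2q_{\mathcal{A}}-1)+\tfrac23q_{\mathcal{A}}^3+6q_{\mathcal{A}}^2+\tfrac73q_{\mathcal{A}}+qn+q-q_{\mathcal{A}}n+mn,$$ and $\eta_{\rm mat}(q_{\mathcal{A}})=\eta(q_{\mathcal{A}})-\eta_{\rm inv}(q_{\mathcal{A}})$. *)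

theory Defs
  imports
    Complex_Main
    "Jordan_Normal_Form.Spectral_Radius"
    "Jordan_Normal_Form.DL_Rank"
    "Jordan_Normal_Form.DL_Submatrix"
begin

definition pos_semidef :: "nat \<Rightarrow> real mat \<Rightarrow> bool" where
  "pos_semidef d M \<longleftrightarrow> M \<in> carrier_mat d d \<and> transpose_mat M = M \<and>
     (\<forall>v \<in> carrier_vec d. 0 \<le> v \<bullet> (M *\<^sub>v v))"

definition pos_def :: "nat \<Rightarrow> real mat \<Rightarrow> bool" where
  "pos_def d M \<longleftrightarrow> M \<in> carrier_mat d d \<and> transpose_mat M = M \<and>
     (\<forall>v \<in> carrier_vec d. v \<noteq> 0\<^sub>v d \<longrightarrow> 0 < v \<bullet> (M *\<^sub>v v))"

definition stabilizable :: "nat \<Rightarrow> nat \<Rightarrow> real mat \<Rightarrow> real mat \<Rightarrow> bool" where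
  "stabilizable n m A B \<longleftrightarrow>
     (\<exists>K \<in> carrier_mat m n. spectral_radius (map_mat complex_of_real (A + B * K)) < 1)"

text \<open>Polytopes are given by half-space representations: each row of \<open>C\<close> is one scalar
  constraint, and the number of scalar constraints depends on the representation.\<close>

definition polyhedron :: "nat \<Rightarrow> real mat \<Rightarrow> real vec \<Rightarrow> real vec set" where
  "polyhedron d C c = {v \<in> carrier_vec d. C *\<^sub>v v \<le> c}"

text \<open>A polyhedron is closed, so compactness amounts to boundedness. The last conjunct says that
  the origin is an interior point (with respect to the maximum norm).\<close>

definition compact_polytope_0_interior :: "nat \<Rightarrow> real mat \<Rightarrow> real vec \<Rightarrow> bool" where
  "compact_polytope_0_interior d C c \<longleftrightarrow>
     C \<in> carrier_mat (dim_row C) d \<and> c \<in> carrier_vec (dim_row C) \<and>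
     (\<exists>b. \<forall>v \<in> polyhedron d C c. \<forall>i < d. \<bar>v $ i\<bar> \<le> b) \<and>
     (\<exists>\<epsilon> > 0. \<forall>v \<in> carrier_vec d. (\<forall>i < d. \<bar>v $ i\<bar> < \<epsilon>) \<longrightarrow> v \<in> polyhedron d C c)"

text \<open>The constraints \<open>lo \<le> v \<le> hi\<close>, written as the \<open>2 d\<close> scalar constraints
  \<open>v \<le> hi\<close>, \<open>- v \<le> - lo\<close>.\<close>

definition box_constraints :: "nat \<Rightarrow> real mat \<Rightarrow> real vec \<Rightarrow> bool" where
  "box_constraints d C c \<longleftrightarrow>
     (\<exists>lo \<in> carrier_vec d. \<exists>hi \<in> carrier_vec d.
        C = 1\<^sub>m d @\<^sub>r (- 1\<^sub>m d) \<and> c = hi @\<^sub>v (- lo))"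


text \<open>An input sequence is stacked as \<open>U = (u(0)', \<dots>, u(N-1)')'\<close>.\<close>

definition inp :: "nat \<Rightarrow> real vec \<Rightarrow> nat \<Rightarrow> real vec" where
  "inp m U k = vec m (\<lambda>i. U $ (k * m + i))"

primrec traj :: "nat \<Rightarrow> real mat \<Rightarrow> real mat \<Rightarrow> real vec \<Rightarrow> real vec \<Rightarrow> nat \<Rightarrow> real vec" where
  "traj m A B x U 0 = x"
| "traj m A B x U (Suc k) = A *\<^sub>v traj m A B x U k + B *\<^sub>v inp m U k"

definition ocp_cost ::
  "nat \<Rightarrow> nat \<Rightarrow> real mat \<Rightarrow> real mat \<Rightarrow> real mat \<Rightarrow> real mat \<Rightarrow> real mat \<Rightarrow> real vec \<Rightarrow> real vec \<Rightarrow> real" where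
  "ocp_cost m N A B P Q R x U =
     traj m A B x U N \<bullet> (P *\<^sub>v traj m A B x U N) +
     (\<Sum>k<N. traj m A B x U k \<bullet> (Q *\<^sub>v traj m A B x U k) + inp m U k \<bullet> (R *\<^sub>v inp m U k))"

text \<open>All scalar constraints of the optimal control problem, each one in the form
  \<open>residual \<le> 0\<close>.\<close>

definition ocp_residual ::
  "nat \<Rightarrow> nat \<Rightarrow> real mat \<Rightarrow> real mat \<Rightarrow> real mat \<Rightarrow> real vec \<Rightarrow> real mat \<Rightarrow> real vec \<Rightarrow>
   real mat \<Rightarrow> real vec \<Rightarrow> real vec \<Rightarrow> real vec \<Rightarrow> real vec" where
  "ocp_residual m N A B Cu cu Cx cx Ct ct x U = vec_of_list
     (concat (map (\<lambda>k. list_of_vec (Cu *\<^sub>v inp m U k - cu) @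
                       list_of_vec (Cx *\<^sub>v traj m A B x U k - cx)) [0..<N]) @
      list_of_vec (Ct *\<^sub>v traj m A B x U N - ct))"

text \<open>The half-space representations \<open>(Cu, cu)\<close>, \<open>(Cx, cx)\<close>, \<open>(Ct, ct)\<close> describe the input,
  state and terminal sets. The assumption \<open>cost_eq\<close> allows the costs to differ by a term \<open>r x\<close>
  that does not depend on the decision variable. The equations \<open>cost_eq\<close> and \<open>constraints_eq\<close>
  determine \<open>H\<close> (being symmetric), \<open>F\<close>, \<open>G\<close>, \<open>E\<close> and \<open>w\<close> uniquely.\<close>

locale mpc_qp =
  fixes n m N q :: nat
    and A B P Q R :: "real mat"
    and Cu :: "real mat" and cu :: "real vec"
    and Cx :: "real mat" and cx :: "real vec"
    and Ct :: "real mat" and ct :: "real vec"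
    and H F G E :: "real mat" and w :: "real vec"
  assumes n_pos: "1 \<le> n" and m_pos: "1 \<le> m"
    and A: "A \<in> carrier_mat n n" and B: "B \<in> carrier_mat n m"
    and P: "pos_def n P" and Q: "pos_semidef n Q" and R: "pos_def m R"
    and stabilizable: "stabilizable n m A B"
    and input_set: "compact_polytope_0_interior m Cu cu"
    and state_set: "compact_polytope_0_interior n Cx cx"
    and terminal_set: "compact_polytope_0_interior n Ct ct"
    and terminal_subset: "polyhedron n Ct ct \<subseteq> polyhedron n Cx cx"
    and q: "q = N * (dim_row Cu + dim_row Cx) + dim_row Ct"
    and H: "pos_def (m * N) H" and F: "F \<in> carrier_mat n (m * N)"
    and G: "G \<in> carrier_mat q (m * N)" and E: "E \<in> carrier_mat q n"
    and w: "w \<in> carrier_vec q"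
    and cost_eq: "\<exists>r. \<forall>x \<in> carrier_vec n. \<forall>U \<in> carrier_vec (m * N).
      ocp_cost m N A B P Q R x U = 1/2 * (U \<bullet> (H *\<^sub>v U)) + x \<bullet> (F *\<^sub>v U) + r x"
    and constraints_eq: "\<forall>x \<in> carrier_vec n. \<forall>U \<in> carrier_vec (m * N).
      G *\<^sub>v U - E *\<^sub>v x - w = ocp_residual m N A B Cu cu Cx cx Ct ct x U"

definition qp_feasible :: "real mat \<Rightarrow> real mat \<Rightarrow> real vec \<Rightarrow> real vec \<Rightarrow> real vec \<Rightarrow> bool" where
  "qp_feasible G E w x U \<longleftrightarrow> U \<in> carrier_vec (dim_col G) \<and> G *\<^sub>v U - E *\<^sub>v x \<le> w"

definition qp_optimizer ::
  "real mat \<Rightarrow> real mat \<Rightarrow> real mat \<Rightarrow> real mat \<Rightarrow> real vec \<Rightarrow> real vec \<Rightarrow> real vec \<Rightarrow> bool" where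
  "qp_optimizer H F G E w x U \<longleftrightarrow> qp_feasible G E w x U \<and>
     (\<forall>V. qp_feasible G E w x V \<longrightarrow>
        1/2 * (U \<bullet> (H *\<^sub>v U)) + x \<bullet> (F *\<^sub>v U) \<le> 1/2 * (V \<bullet> (H *\<^sub>v V)) + x \<bullet> (F *\<^sub>v V))"

text \<open>Constraint indices start from 0.\<close>

definition active_set :: "real mat \<Rightarrow> real mat \<Rightarrow> real vec \<Rightarrow> real vec \<Rightarrow> real vec \<Rightarrow> nat set" where
  "active_set G E w x U = {i. i < dim_row G \<and> row G i \<bullet> U - row E i \<bullet> x = w $ i}"

definition rows_of :: "'a mat \<Rightarrow> nat set \<Rightarrow> 'a mat" where
  "rows_of M S = submatrix M S UNIV"

text \<open>\<^const>\<open>vec_space.rank\<close> takes the number of rows of the matrix as its first argument.\<close>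

definition full_row_rank :: "real mat \<Rightarrow> bool" where
  "full_row_rank M \<longleftrightarrow> vec_space.rank (dim_row M) M = dim_row M"


definition eta_inv :: "nat \<Rightarrow> real" where
  "eta_inv qA = (2 * real qA ^ 3 + 18 * real qA ^ 2 + 10 * real qA) / 3"

definition eta :: "nat \<Rightarrow> nat \<Rightarrow> nat \<Rightarrow> nat \<Rightarrow> nat \<Rightarrow> real" where
  "eta n m N q qA =
     (real m * real N * real qA + real m * real n + real q * real qA) * (2 * real m * real N - 1)
     + (real q * real n + real q + real m + real m * real n) * (2 * real qA - 1)
     + 2/3 * real qA ^ 3 + 6 * real qA ^ 2 + 7/3 * real qA
     + real q * real n + real q - real qA * real n + real m * real n"

definition eta_mat :: "nat \<Rightarrow> nat \<Rightarrow> nat \<Rightarrow> nat \<Rightarrow> nat \<Rightarrow> real" where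
  "eta_mat n m N q qA = eta n m N q qA - eta_inv qA"

text \<open>The closed formula for \<^const>\<open>eta\<close> is the flop count of the operations listed in
  \<open>A1_mat_ops\<close> together with one inversion. \<open>Mult r k c\<close> is the product of an \<open>r \<times> k\<close> and a
  \<open>k \<times> c\<close> matrix (\<open>k\<close> multiplications and \<open>k - 1\<close> additions per entry), \<open>Add r c\<close> the sum or
  difference of two \<open>r \<times> c\<close> matrices. The matrices \<open>H\<^sup>-\<^sup>1\<close> and \<open>S\<close> do not depend on the active set
  and are available beforehand; sign changes are not counted.\<close>

datatype mat_op = Mult nat nat nat | Add nat nat

fun flops :: "mat_op \<Rightarrow> real" where
  "flops (Mult r k c) = real r * real c * (2 * real k - 1)"
| "flops (Add r c) = real r * real c"

definition A1_mat_ops :: "nat \<Rightarrow> nat \<Rightarrow> nat \<Rightarrow> nat \<Rightarrow> nat \<Rightarrow> mat_op list" where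
  "A1_mat_ops n m N q qA =
    [Mult (m * N) (m * N) qA,   \<comment> \<open>\<open>Y = H\<^sup>-\<^sup>1 G\<^sub>A'\<close>; its first \<open>m\<close> rows are \<open>Y\<^sub>M\<close>\<close>
     Mult qA (m * N) qA,        \<comment> \<open>\<open>G\<^sub>A Y\<close>, the matrix whose inverse is \<open>\<Phi>\<close>\<close>
     Mult (q - qA) (m * N) qA,  \<comment> \<open>\<open>Z = G\<^sub>I Y\<close>\<close>
     Mult m (m * N) n,          \<comment> \<open>\<open>H\<^sup>-\<^sup>1\<^sub>M F'\<close>\<close>
     Mult qA qA n,              \<comment> \<open>\<open>\<Phi> S\<^sub>A\<close>, the lower block of \<open>T\<close>\<close>
     Mult qA qA 1,              \<comment> \<open>\<open>\<Phi> w\<^sub>A\<close>, giving the lower block of \<open>d\<close>\<close>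
     Mult (q - qA) qA n,        \<comment> \<open>\<open>Z (\<Phi> S\<^sub>A)\<close>\<close>
     Add (q - qA) n,            \<comment> \<open>\<open>Z (\<Phi> S\<^sub>A) - S\<^sub>I\<close>, the upper block of \<open>T\<close>\<close>
     Mult (q - qA) qA 1,        \<comment> \<open>\<open>Z (\<Phi> w\<^sub>A)\<close>\<close>
     Add (q - qA) 1,            \<comment> \<open>\<open>Z (\<Phi> w\<^sub>A) - w\<^sub>I\<close>, giving the upper block of \<open>d\<close>\<close>
     Mult m qA n,               \<comment> \<open>\<open>Y\<^sub>M (\<Phi> S\<^sub>A)\<close>\<close>
     Add m n,                   \<comment> \<open>\<open>K = Y\<^sub>M (\<Phi> S\<^sub>A) - H\<^sup>-\<^sup>1\<^sub>M F'\<close>\<close>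
     Mult m qA 1]               \<comment> \<open>\<open>b = Y\<^sub>M (\<Phi> w\<^sub>A)\<close>\<close>"

lemma eta_mat_eq_flops:
  assumes "qA \<le> q"
  shows "eta_mat n m N q qA = sum_list (map flops (A1_mat_ops n m N q qA))"
  using assms
  by (simp add: eta_mat_def eta_def eta_inv_def A1_mat_ops_def of_nat_diff field_simps
      power2_eq_square power3_eq_cube)

end

(* Full row rank of G_A forces q_A <= M for M := m N. As a function of q_A, eta_mat is affine with
   constant term m n (2 M - 1) - m >= M >= q_A, and n >= 1, N >= 2 give q >= 2 M + 6; hence eta_mat
   >= q_A (6 M^2 + 17 M + 21). On the other side eta_inv <= q_A (2 M^2 + 18 M + 10) / 3, and
   54 (6 M^2 + 17 M + 21) - 79 (2 M^2 + 18 M + 10) = (M - 2) (166 M - 172) >= 0.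
   For m = n = 1, N = 2, q_A = 2 all these estimates are equalities. *)
theory Submission
  imports Defs
begin

text \<open>The rank is the dimension of the column span, so the columns bound it. For a matrix of
  full row rank this becomes a bound on the number of rows.\<close>

lemma rank_le_dim_col:
  fixes M :: "'a :: field mat"
  shows "vec_space.rank (dim_row M) M \<le> dim_col M"
  using vec_space.rank_le_nc[of M "dim_row M" "dim_col M"] by auto

lemma dim_row_box_constraints:
  assumes "box_constraints d C c"
  shows "dim_row C = 2 * d"
  using assms by (auto simp: box_constraints_def append_rows_def)

lemma dim_rows_of:
  assumes "S \<subseteq> {..<dim_row M}"
  shows "dim_row (rows_of M S) = card S" "dim_col (rows_of M S) = dim_col M"
proof -
  \<comment> \<open>\<open>submatrix\<close> drops indices that are out of range, hence the
    assumption on \<open>S\<close>.\<close>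
  have "{i. i < dim_row M \<and> i \<in> S} = S"
    using assms by auto
  then show "dim_row (rows_of M S) = card S"
    by (simp add: rows_of_def dim_submatrix)
  show "dim_col (rows_of M S) = dim_col M"
    by (simp add: rows_of_def dim_submatrix)
qed

text \<open>The cubic and quadratic terms in \<open>a\<close> are exactly those of
  \<open>eta_inv\<close>; the linear rest 7/3 - 10/3 gives the final -1 of the slope. In the
  constant term, \<open>q * n + q + m * n\<close> cancels and only \<open>- m\<close>
  survives.\<close>

lemma eta_mat_affine:
  "eta_mat n m N q a =
     real a * ((real m * N + q) * (2 * real m * N - 1) + 2 * real q * (n + 1) + 2 * real m * (n + 1) - n - 1)
     + (real m * n * (2 * real m * N - 1) - m)"
  by (simp add: eta_mat_def eta_def eta_inv_def algebra_simps)

lemma eta_mat_lower_bound: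
  assumes n: "1 \<le> n" and m: "1 \<le> m" and N: "1 < N"
    and q: "q = 2 * m * N + 2 * n * N + 2 * n" and a: "a \<le> m * N"
  shows "real a * (6 * (real m * N)^2 + 17 * (real m * N) + 21) \<le> eta_mat n m N q a"
proof -
  define M where "M = real m * real N"
  have "2 \<le> m * N"
    using mult_le_mono[of 1 m 2 N] m N by simp
  then have M: "2 \<le> M"
    unfolding M_def by (metis of_nat_le_iff of_nat_mult of_nat_numeral)
  have aM: "real a \<le> M"
    using a unfolding M_def by (metis of_nat_le_iff of_nat_mult)
  have mn: "real m \<le> real m * real n" "real n \<le> real m * real n" "1 \<le> real m"
    using m n by auto
  have nN: "2 \<le> real n * real N"
    using mult_mono[of 1 "real n" 2 "real N"] n N by simp
  \<comment> \<open>The summand 2nN contributes at least 4, the summand 2n at least 2.\<close>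
  have qM: "2 * M + 6 \<le> real q"
    using nN n unfolding q M_def by simp
  \<comment> \<open>The constant term is at least m (2 M - 2), and 2 M - 2 >= M because M >= 2. It
    pays for one more \<open>a\<close>, which raises 20 to 21 below.\<close>
  have const: "real a \<le> real m * n * (2 * M - 1) - m"
  proof -
    have "real m * (2 * M - 1) \<le> real m * n * (2 * M - 1)"
      using mn M by (intro mult_right_mono) auto
    moreover have "1 * (2 * M - 2) \<le> real m * (2 * M - 2)"
      using mn M by (intro mult_right_mono) auto
    ultimately show ?thesis
      using aM M by (simp add: algebra_simps)
  qed
  have "(3 * M + 6) * (2 * M - 1) \<le> (M + q) * (2 * M - 1)"
    using qM M by (intro mult_right_mono) auto
  moreover have "(2 * M + 6) * 2 \<le> real q * (n + 1)"
    using qM M n by (intro mult_mono) auto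
  moreover have "3 \<le> 2 * real m * (n + 1) - n"
  proof -
    have "2 * real m * (n + 1) = 2 * real m + 2 * (real m * n)"
      by (simp add: algebra_simps)
    moreover have "1 \<le> real n"
      using n by simp
    ultimately show ?thesis
      using mn by linarith
  qed
  \<comment> \<open>The bounds add up to (3 M + 6) (2 M - 1) + 4 (2 M + 6) + 3 - 1.\<close>
  ultimately have slope: "6 * M^2 + 17 * M + 20 \<le>
      (M + q) * (2 * M - 1) + 2 * real q * (n + 1) + 2 * real m * (n + 1) - n - 1"
    by (simp add: algebra_simps power2_eq_square)
  have "real a * (6 * M^2 + 17 * M + 21) = real a * (6 * M^2 + 17 * M + 20) + real a"
    by (simp add: algebra_simps)
  also have "\<dots> \<le> real a * ((M + q) * (2 * M - 1) + 2 * real q * (n + 1) + 2 * real m * (n + 1) - n - 1)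
      + (real m * n * (2 * M - 1) - m)"
    by (intro add_mono mult_left_mono slope const) simp
  also have "\<dots> = eta_mat n m N q a"
    by (simp add: eta_mat_affine M_def mult.assoc)
  finally show ?thesis
    by (simp add: M_def)
qed

text \<open>Only the quadratic cofactor is estimated at \<open>M\<close>; the factor
  \<open>a\<close> stays, to match the one in the lower bound for \<open>eta_mat\<close>.\<close>

lemma eta_inv_upper_bound:
  assumes "real a \<le> M"
  shows "eta_inv a \<le> real a * ((2 * M^2 + 18 * M + 10) / 3)"
proof -
  have "eta_inv a = real a * ((2 * (real a)^2 + 18 * real a + 10) / 3)"
    by (simp add: eta_inv_def algebra_simps power2_eq_square power3_eq_cube)
  also have "\<dots> \<le> real a * ((2 * M^2 + 18 * M + 10) / 3)"
    using assms by (intro mult_left_mono divide_right_mono add_mono power_mono) auto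
  finally show ?thesis .
qed

lemma eta_ratio_bound:
  assumes n: "1 \<le> n" and m: "1 \<le> m" and N: "1 < N"
    and q: "q = 2 * m * N + 2 * n * N + 2 * n" and a: "a \<le> m * N"
  shows "eta_inv a / eta_mat n m N q a \<le> 18 / 79"
\<comment> \<open>For \<open>a = 0\<close> the lower bound does not show that the denominator is
  positive, but the numerator vanishes.\<close>
proof (cases "a = 0")
  case True
  then show ?thesis
    by (simp add: eta_inv_def)
next
  case False
  define M where "M = real m * real N"
  have "2 \<le> m * N"
    using mult_le_mono[of 1 m 2 N] m N by simp
  then have M: "2 \<le> M"
    unfolding M_def by (metis of_nat_le_iff of_nat_mult of_nat_numeral)
  have aM: "real a \<le> M"
    using a unfolding M_def by (metis of_nat_le_iff of_nat_mult)
  have low: "real a * (6 * M^2 + 17 * M + 21) \<le> eta_mat n m N q a"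
    using eta_mat_lower_bound[OF n m N q a] by (simp add: M_def)
  have "0 < real a * (6 * M^2 + 17 * M + 21)"
    using False M by (intro mult_pos_pos add_nonneg_pos) auto
  with low have pos: "0 < eta_mat n m N q a"
    by linarith
  \<comment> \<open>This product is three times the difference of the two sides of the next
    inequality. At M = 2 the cofactors of \<open>a\<close> are 18 and 79, whence the
    constant.\<close>
  have "0 \<le> (M - 2) * (166 * M - 172)"
    using M by simp
  then have "79 * ((2 * M^2 + 18 * M + 10) / 3) \<le> 18 * (6 * M^2 + 17 * M + 21)"
    by (simp add: algebra_simps power2_eq_square)
  then have "real a * (79 * ((2 * M^2 + 18 * M + 10) / 3)) \<le>
      real a * (18 * (6 * M^2 + 17 * M + 21))"
    by (rule mult_left_mono) simp
  then have "79 * eta_inv a \<le> 18 * eta_mat n m N q a"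
    using eta_inv_upper_bound[OF aM] low by linarith
  with pos show ?thesis
    by (simp add: field_simps)
qed

theorem proposition6:
  fixes n m N q :: nat
    and A B P Q R Cu Cx Ct H F G E :: "real mat"
    and cu cx ct w x Ustar :: "real vec"
  assumes setting: "mpc_qp n m N q A B P Q R Cu cu Cx cx Ct ct H F G E w"
    and x: "x \<in> carrier_vec n"
    and optimizer: "qp_optimizer H F G E w x Ustar"
    and rank: "full_row_rank (rows_of G (active_set G E w x Ustar))"
    and box_u: "box_constraints m Cu cu"
    and box_x: "box_constraints n Cx cx"
    and box_t: "box_constraints n Ct ct"
    and N: "N > 1"
  shows "eta_inv (card (active_set G E w x Ustar)) /
         eta_mat n m N q (card (active_set G E w x Ustar)) \<le> 18 / 79"
proof -
  interpret mpc_qp n m N q A B P Q R Cu cu Cx cx Ct ct H F G E w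
    by (rule setting)
  let ?S = "active_set G E w x Ustar"
  have S: "?S \<subseteq> {..<dim_row G}"
    by (auto simp: active_set_def)
  have "card ?S \<le> dim_col G"
    using rank rank_le_dim_col[of "rows_of G ?S"] by (simp add: full_row_rank_def dim_rows_of[OF S])
  then have card: "card ?S \<le> m * N"
    using G by auto
  \<comment> \<open>A box in dimension d has 2 d scalar constraints; there are N input boxes, N
    state boxes and one terminal box.\<close>
  have "q = 2 * m * N + 2 * n * N + 2 * n"
    using q by (simp add: dim_row_box_constraints[OF box_u] dim_row_box_constraints[OF box_x]
        dim_row_box_constraints[OF box_t] algebra_simps)
  from eta_ratio_bound[OF n_pos m_pos N this card] show ?thesis .
qed

end
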